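(* Let $0<q<1$, let $N\ge1$ be an integer and let $\widetilde\alpha,\widetilde\beta$ be real with either $0<\widetilde\alpha q<1$, $0<\widetilde\beta q<1$, or $\widetilde\alpha>q^{-N}$, $\widetilde\beta>q^{-N}$. Let $\alpha,\beta\in\mathbb R$ be given by $q^\alpha=\widetilde\beta$, $q^\beta=\widetilde\alpha$, and for real $a$ let $b=a+N+1$ (so $q^{-b}=q^{-N-1-a}$). Put $$\widetilde\mu(s)=q^{a+1}\frac{\mu(s+a)}{c_1},\qquad C_n=q^{\frac n2(2a+1)}\kappa_q^{2n},\qquad x(s)=q^{-s}.$$ Then, as $q^a\to0$ (i.e. $a\to+\infty$), $\widetilde\mu(s)\to x(s)$, and for all $0\le n\le N$ and $s=0,1,\dots,N$, $$\lim_{q^a\to0}C_n\,u_n^{\alpha,\beta}(\mu(s+a),a,b)_q=h_n^{\widetilde\alpha,\widetilde\beta}(x(s);N|q),$$ where $h_n^{\widetilde\alpha,\widetilde\beta}$ are the monic $q$-Hahn polynomials.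
   Context: Notation. $0<q<1$, $q^z=e^{z\log q}$. $(x;q)_k=\prod_{i=0}^{k-1}(1-xq^i)$, $(x_1,\dots,x_r;q)_k=\prod_j(x_j;q)_k$; ${}_r\varphi_{r-1}$ is the standard basic hypergeometric series. $\kappa_q=q^{1/2}-q^{-1/2}$; $[s]_q=\dfrac{q^{s/2}-q^{-s/2}}{q^{1/2}-q^{-1/2}}$. Lattice: $\mu(s)=[s]_q[s+1]_q=c_1(q^s+q^{-s-1})+c_3$ with $c_1=q^{1/2}\kappa_q^{-2}$, $c_3=-q^{-1/2}(1+q)\kappa_q^{-2}$. Non-standard monic $q$-Racah polynomials ($0\le n\le b-a-1$): $$u_n^{\alpha,\beta}(s)_q=u_n^{\alpha,\beta}(\mu(s),a,b)_q=q^{-\frac n2(2a+1)}\frac{(q^{a-b+1},q^{\beta+1},q^{a+b+\alpha+1};q)_n}{\kappa_q^{2n}(q^{\alpha+\beta+n+1};q)_n}\;{}_4\varphi_3\!\left(\begin{matrix}q^{-n},q^{\alpha+\beta+n+1},q^{a-s},q^{a+s+1}\\ q^{a-b+1},q^{\beta+1},q^{a+b+\alpha+1}\end{matrix}\Big|\,q,q\right).$$ Monic $q$-Hahn polynomials: $$h_n^{\widetilde\alpha,\widetilde\beta}(x(s);N|q)=\frac{(q^{-N},\widetilde\alpha q;q)_n}{(\widetilde\alpha\widetilde\beta q^{n+1};q)_n}\;{}_3\varphi_2\!\left(\begin{matrix}q^{-n},\widetilde\alpha\widetilde\beta q^{n+1},x(s)\\ q^{-N},\widetilde\alpha q\end{matrix}\Big|\,q,q\right),\qquad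 x(s)=q^{-s}.$$ *)

theory Defs
  imports "HOL-Analysis.Analysis"
begin

(* For 0 < q, the library's powr on complex numbers is q^z = exp (z * log q)
   with the real logarithm. *)
abbreviation qpow :: "real \<Rightarrow> complex \<Rightarrow> complex" where
  "qpow q z \<equiv> complex_of_real q powr z"

definition qpoch :: "complex \<Rightarrow> complex \<Rightarrow> nat \<Rightarrow> complex" where
  "qpoch x q k = (\<Prod>i<k. 1 - x * q ^ i)"

definition qpochs :: "complex list \<Rightarrow> complex \<Rightarrow> nat \<Rightarrow> complex" where
  "qpochs xs q k = (\<Prod>x\<leftarrow>xs. qpoch x q k)"

(* The series with r upper and s lower parameters, in the normalisation of Gasper and Rahman;
   for s = r - 1 the factor raised to the power 1 + s - r is 1.  If some upper parameter is
   q^(-n) the terms with k > n vanish, also when a lower parameter makes a later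
   denominator 0, since x / 0 = 0; so the sum is the usual terminating one. *)
definition basic_hypergeometric ::
    "complex list \<Rightarrow> complex list \<Rightarrow> complex \<Rightarrow> complex \<Rightarrow> complex" where
  "basic_hypergeometric as bs q z =
     (\<Sum>k. qpochs as q k / (qpochs bs q k * qpoch q q k)
           * ((- 1) ^ k * q ^ (k choose 2)) powi (1 + int (length bs) - int (length as))
           * z ^ k)"

definition kappa :: "real \<Rightarrow> complex" where
  "kappa q = qpow q (1/2) - qpow q (- 1/2)"

definition qnum :: "real \<Rightarrow> complex \<Rightarrow> complex" where
  "qnum q s = (qpow q (s/2) - qpow q (- s/2)) / (qpow q (1/2) - qpow q (- 1/2))"

definition mu :: "real \<Rightarrow> complex \<Rightarrow> complex" where
  "mu q s = qnum q s * qnum q (s + 1)"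

definition c1 :: "real \<Rightarrow> complex" where
  "c1 q = qpow q (1/2) / kappa q ^ 2"

definition c3 :: "real \<Rightarrow> complex" where
  "c3 q = - qpow q (- 1/2) * (1 + of_real q) / kappa q ^ 2"

lemma mu_eq:
  assumes "0 < q"
  shows "mu q s = c1 q * (qpow q s + qpow q (- s - 1)) + c3 q"
proof -
  have P: "qpow q x * qpow q y = qpow q (x + y)" for x y
    by (simp add: powr_add)
  have one: "qpow q 1 = of_real q" using assms by auto
  have "(qpow q (s/2) - qpow q (- s/2)) * (qpow q ((s+1)/2) - qpow q (- (s+1)/2))
      = qpow q (s/2 + (s+1)/2) - qpow q (s/2 + - (s+1)/2)
        - (qpow q (- s/2 + (s+1)/2) - qpow q (- s/2 + - (s+1)/2))"
    by (simp only: left_diff_distrib right_diff_distrib P) simp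
  also have "s/2 + (s+1)/2 = s + 1/2" by (simp add: field_simps)
  also have "s/2 + - (s+1)/2 = - 1/2" by (simp add: field_simps)
  also have "- s/2 + (s+1)/2 = 1/2" by (simp add: field_simps)
  also have "- s/2 + - (s+1)/2 = - s - 1/2" by (simp add: field_simps)
  finally have A: "(qpow q (s/2) - qpow q (- s/2)) * (qpow q ((s+1)/2) - qpow q (- (s+1)/2))
      = qpow q (s + 1/2) - qpow q (- 1/2) - (qpow q (1/2) - qpow q (- s - 1/2))" .
  have "1/2 + s = s + 1/2" "1/2 + (- s - 1) = - s - 1/2" by (simp_all add: field_simps)
  then have B: "qpow q (1/2) * (qpow q s + qpow q (- s - 1))
      = qpow q (s + 1/2) + qpow q (- s - 1/2)"
    by (simp only: distrib_left P)
  have C: "qpow q (- 1/2) * (1 + of_real q) = qpow q (- 1/2) + qpow q (1/2)"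
    using P[of "- 1/2" 1] one by (simp add: algebra_simps)
  have "mu q s = ((qpow q (s/2) - qpow q (- s/2)) * (qpow q ((s+1)/2) - qpow q (- (s+1)/2)))
                 / kappa q ^ 2"
    by (simp add: mu_def qnum_def kappa_def power2_eq_square)
  also have "\<dots> = (qpow q (1/2) * (qpow q s + qpow q (- s - 1))
                 - qpow q (- 1/2) * (1 + of_real q)) / kappa q ^ 2"
    unfolding A B C by (simp add: algebra_simps)
  finally show ?thesis
    by (simp add: c1_def c3_def diff_divide_distrib)
qed

(* The value at the lattice point s of the monic polynomial of degree n in mu(s). *)
definition racah_u ::
    "real \<Rightarrow> complex \<Rightarrow> complex \<Rightarrow> complex \<Rightarrow> complex \<Rightarrow> nat \<Rightarrow> complex \<Rightarrow> complex" where
  "racah_u q \<alpha> \<beta> a b n s =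
     qpow q (- (of_nat n / 2) * (2 * a + 1))
     * qpochs [qpow q (a - b + 1), qpow q (\<beta> + 1), qpow q (a + b + \<alpha> + 1)] (of_real q) n
     / (kappa q ^ (2 * n) * qpoch (qpow q (\<alpha> + \<beta> + of_nat n + 1)) (of_real q) n)
     * basic_hypergeometric
         [qpow q (- of_nat n), qpow q (\<alpha> + \<beta> + of_nat n + 1), qpow q (a - s), qpow q (a + s + 1)]
         [qpow q (a - b + 1), qpow q (\<beta> + 1), qpow q (a + b + \<alpha> + 1)]
         (of_real q) (of_real q)"

definition hahn_h ::
    "real \<Rightarrow> complex \<Rightarrow> complex \<Rightarrow> nat \<Rightarrow> nat \<Rightarrow> complex \<Rightarrow> complex" where
  "hahn_h q \<alpha>t \<beta>t N n x =
     qpochs [qpow q (- of_nat N), \<alpha>t * of_real q] (of_real q) n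
     / qpoch (\<alpha>t * \<beta>t * of_real q ^ (n + 1)) (of_real q) n
     * basic_hypergeometric
         [qpow q (- of_nat n), \<alpha>t * \<beta>t * of_real q ^ (n + 1), x]
         [qpow q (- of_nat N), \<alpha>t * of_real q]
         (of_real q) (of_real q)"

definition x_lattice :: "real \<Rightarrow> complex \<Rightarrow> complex" where
  "x_lattice q s = qpow q (- s)"

definition mu_tilde :: "real \<Rightarrow> complex \<Rightarrow> complex \<Rightarrow> complex" where
  "mu_tilde q a s = qpow q (a + 1) * (mu q (s + a) / c1 q)"

definition C_factor :: "real \<Rightarrow> complex \<Rightarrow> nat \<Rightarrow> complex" where
  "C_factor q a n = qpow q (of_nat n / 2 * (2 * a + 1)) * kappa q ^ (2 * n)"

end

theory Submission
  imports Defs "HOL-Real_Asymp.Real_Asymp"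
begin

text \<open>The factor \<open>C_factor\<close> cancels the normalisation of the \<open>q\<close>-Racah polynomials.
  Since \<open>b = a + N + 1\<close>, what remains depends on \<open>a\<close> only through the upper parameter
  \<open>q\<^sup>2\<^sup>a\<^sup>+\<^sup>s\<^sup>+\<^sup>1\<close> and the lower parameter \<open>q\<^sup>2\<^sup>a\<^sup>+\<^sup>N\<^sup>+\<^sup>\<alpha>\<^sup>+\<^sup>2\<close>.  Both tend to \<open>0\<close>, so their
  Pochhammer symbols tend to \<open>1\<close>, and the limit can be taken termwise in the terminating
  series.\<close>

lemma qpow_linear_tendsto_0:
  fixes q c :: real and z :: complex
  assumes "0 < q" "q < 1" "0 < c"
  shows "((\<lambda>a::real. qpow q (of_real (c * a) + z)) \<longlongrightarrow> 0) at_top"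
proof -
  \<comment> \<open>Decay rate: q^(c a) = exp(- d a), and \<open>d\<close> is positive because ln q
    < 0. The complex offset \<open>z\<close> only contributes the constant factor
    \<open>qpow q z\<close>.\<close>
  define d where "d = - c * ln q"
  have "d > 0"
    using assms by (simp add: d_def mult_pos_neg)
  then have "((\<lambda>a::real. exp (- (d * a))) \<longlongrightarrow> 0) at_top"
    by real_asymp
  moreover have "exp (- (d * a)) = q powr (c * a)" for a
    using assms by (simp add: powr_def d_def mult_ac)
  ultimately have "((\<lambda>a::real. q powr (c * a)) \<longlongrightarrow> 0) at_top"
    by simp
  then have "((\<lambda>a::real. complex_of_real (q powr (c * a)) * qpow q z) \<longlongrightarrow> 0 * qpow q z) at_top"
    by (intro tendsto_mult tendsto_const) (use tendsto_of_real in fastforce)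
  moreover have "complex_of_real (q powr (c * a)) * qpow q z = qpow q (of_real (c * a) + z)" for a
    using assms by (simp add: powr_add flip: powr_of_real)
  ultimately show ?thesis by simp
qed

lemma qpoch_tendsto_1:
  assumes "(f \<longlongrightarrow> 0) F"
  shows "((\<lambda>a. qpoch (f a) q k) \<longlongrightarrow> 1) F"
proof -
  have "((\<lambda>a. \<Prod>i<k. 1 - f a * q ^ i) \<longlongrightarrow> (\<Prod>i<k. 1 - 0 * q ^ i)) F"
    by (intro tendsto_prod tendsto_diff tendsto_mult tendsto_const assms)
  then show ?thesis by (simp add: qpoch_def)
qed

text \<open>For k > n the product contains the factor of index n, which is 1 - q^(-n) q^n =
  0.\<close>

lemma qpoch_terminates:
  assumes "0 < q" "n < k"
  shows "qpoch (qpow q (- of_nat n)) (of_real q) k = 0"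
proof -
  have "qpow q (- of_nat n) * of_real q ^ n = 1"
    using assms by (simp add: powr_minus powr_nat')
  then show ?thesis
    using assms unfolding qpoch_def by (intro prod_zero) (auto intro!: bexI[of _ n])
qed

text \<open>With q^(-n) prepended there is one more upper than lower parameter, so the
  \<open>powi\<close> exponent is 0 and that factor is 1. Terms beyond n have numerator 0, hence
  vanish whatever their denominators are.\<close>

lemma basic_hypergeometric_terminating:
  assumes "0 < q" and "length as = length bs"
  shows "basic_hypergeometric (qpow q (- of_nat n) # as) bs (of_real q) z =
    (\<Sum>k\<le>n. qpochs (qpow q (- of_nat n) # as) (of_real q) k
             / (qpochs bs (of_real q) k * qpoch (of_real q) (of_real q) k) * z ^ k)"
  unfolding basic_hypergeometric_def using assms
  by (subst suminf_finite[where N = "{..n}"]) (auto simp: qpochs_def qpoch_terminates)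

lemma basic_hypergeometric_4_3_tendsto_3_2:
  assumes "0 < q" and f: "(f \<longlongrightarrow> 0) F" and g: "(g \<longlongrightarrow> 0) F"
  shows "((\<lambda>t. basic_hypergeometric [qpow q (- of_nat n), A, x, f t] [B, D, g t] (of_real q) z)
    \<longlongrightarrow> basic_hypergeometric [qpow q (- of_nat n), A, x] [B, D] (of_real q) z) F"
proof -
  let ?Q = "complex_of_real q"
  \<comment> \<open>\<open>T k\<close> is the k-th term of the limit series. The moving parameters
    enter the k-th term of the larger series only through a quotient of two Pochhammer symbols,
    which tends to 1 / 1.\<close>
  define T where "T k = qpochs [qpow q (- of_nat n), A, x] ?Q k
    / (qpochs [B, D] ?Q k * qpoch ?Q ?Q k) * z ^ k" for k
  have "((\<lambda>t. \<Sum>k\<le>n. T k * (qpoch (f t) ?Q k / qpoch (g t) ?Q k))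
      \<longlongrightarrow> (\<Sum>k\<le>n. T k * (1 / 1))) F"
    by (intro tendsto_sum tendsto_mult tendsto_divide tendsto_const qpoch_tendsto_1 f g) simp
  moreover have "basic_hypergeometric [qpow q (- of_nat n), A, x, f t] [B, D, g t] ?Q z
      = (\<Sum>k\<le>n. T k * (qpoch (f t) ?Q k / qpoch (g t) ?Q k))" for t
    using \<open>0 < q\<close>
    by (subst basic_hypergeometric_terminating) (simp_all add: T_def qpochs_def mult_ac)
  moreover have "basic_hypergeometric [qpow q (- of_nat n), A, x] [B, D] ?Q z = (\<Sum>k\<le>n. T k)"
    using \<open>0 < q\<close>
    by (subst basic_hypergeometric_terminating) (simp_all add: T_def)
  ultimately show ?thesis by simp
qed

lemma kappa_nonzero:
  assumes "0 < q" "q < 1"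
  shows "kappa q \<noteq> 0"
proof -
  have "kappa q = of_real (q powr (1/2) - q powr (- 1/2))"
    using assms by (simp add: kappa_def flip: powr_of_real)
  moreover have "q powr (1/2) < q powr (- 1/2)"
    using assms by (intro powr_less_mono') auto
  ultimately show ?thesis by simp
qed

text \<open>By \<open>mu_eq\<close>, mu(s + a) / c1 = q^(s+a) + q^(-s-a-1) + c3 / c1. Multiplication
  by q^(a+1) removes \<open>a\<close> from the second summand, leaving q^(-s), and makes the other
  two decay.\<close>

lemma mu_tilde_tendsto:
  assumes "0 < q" "q < 1"
  shows "((\<lambda>a::real. mu_tilde q (of_real a) s) \<longlongrightarrow> x_lattice q s) at_top"
proof -
  have "c1 q \<noteq> 0"
    using kappa_nonzero[OF assms] assms by (simp add: c1_def)
  \<comment> \<open>The exponents are written with \<open>2 * a\<close> and \<open>1 * a\<close> to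
    match \<open>qpow_linear_tendsto_0\<close>.\<close>
  have "mu_tilde q (of_real a) s = qpow q (of_real (2 * a) + (s + 1)) + qpow q (- s)
      + qpow q (of_real (1 * a) + 1) * (c3 q / c1 q)" for a :: real
  proof -
    have "qpow q (of_real a + 1) * qpow q (s + of_real a) = qpow q (of_real (2 * a) + (s + 1))"
      and "qpow q (of_real a + 1) * qpow q (- (s + of_real a) - 1) = qpow q (- s)"
      unfolding powr_add[symmetric] by (simp_all add: algebra_simps)
    then show ?thesis
      using \<open>c1 q \<noteq> 0\<close> by (simp add: mu_tilde_def mu_eq[OF assms(1)] add_divide_distrib distrib_left)
  qed
  moreover have "((\<lambda>a::real. qpow q (of_real (2 * a) + (s + 1)) + qpow q (- s)
      + qpow q (of_real (1 * a) + 1) * (c3 q / c1 q)) \<longlongrightarrow> 0 + qpow q (- s) + 0 * (c3 q / c1 q)) at_top"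
    by (intro tendsto_intros qpow_linear_tendsto_0 assms) auto
  ultimately show ?thesis by (simp add: x_lattice_def)
qed

lemma C_factor_mult_racah_u:
  assumes "0 < q" "q < 1"
  shows "C_factor q a n * racah_u q \<alpha> \<beta> a b n s =
    qpochs [qpow q (a - b + 1), qpow q (\<beta> + 1), qpow q (a + b + \<alpha> + 1)] (of_real q) n
     / qpoch (qpow q (\<alpha> + \<beta> + of_nat n + 1)) (of_real q) n
     * basic_hypergeometric
         [qpow q (- of_nat n), qpow q (\<alpha> + \<beta> + of_nat n + 1), qpow q (a - s), qpow q (a + s + 1)]
         [qpow q (a - b + 1), qpow q (\<beta> + 1), qpow q (a + b + \<alpha> + 1)]
         (of_real q) (of_real q)"
proof -
  have "qpow q (of_nat n / 2 * (2 * a + 1)) * qpow q (- (of_nat n / 2) * (2 * a + 1)) = 1"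
    using assms by (simp flip: powr_add)
  \<comment> \<open>\<open>P\<close>, \<open>R\<close>, \<open>S\<close> stand for the rest of the
    formula; if \<open>R\<close> is 0, both sides are 0.\<close>
  then have "C_factor q a n * (qpow q (- (of_nat n / 2) * (2 * a + 1)) * P / (kappa q ^ (2 * n) * R) * S)
      = P / R * S" for P R S
    using kappa_nonzero[OF assms] by (simp add: C_factor_def field_simps)
  then show ?thesis unfolding racah_u_def .
qed

text \<open>The parameters cross: the lower parameter q^(\<beta>+1) must become the first q-Hahn
  parameter times q, so that parameter is q^\<beta> and the second one is q^\<alpha>.\<close>

lemma racah_u_tendsto_hahn_h:
  fixes q \<alpha> \<beta> :: real and s :: complex
  assumes "0 < q" "q < 1"
  shows "((\<lambda>a::real. C_factor q (of_real a) n
      * racah_u q (of_real \<alpha>) (of_real \<beta>) (of_real a) (of_real (a + real N + 1)) n (s + of_real a))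
    \<longlongrightarrow> hahn_h q (of_real (q powr \<beta>)) (of_real (q powr \<alpha>)) N n (x_lattice q s)) at_top"
proof -
  let ?Q = "complex_of_real q"
  define f where "f a = qpow q (of_real (2 * a) + (s + 1))" for a :: real
  define g where "g a = qpow q (of_real (2 * a) + of_real (real N + \<alpha> + 2))" for a :: real
  let ?A = "of_real (q powr \<beta>) * of_real (q powr \<alpha>) * ?Q ^ (n + 1)"
  let ?B = "qpow q (- of_nat N)"
  let ?D = "of_real (q powr \<beta>) * ?Q"
  have f: "(f \<longlongrightarrow> 0) at_top" and g: "(g \<longlongrightarrow> 0) at_top"
    unfolding f_def g_def by (intro qpow_linear_tendsto_0 assms; simp)+
  have A: "qpow q (of_real \<alpha> + of_real \<beta> + of_nat n + 1) = ?A"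
    using assms by (simp add: powr_add powr_nat' flip: powr_of_real)
  have D: "qpow q (of_real \<beta> + 1) = ?D"
    using assms by (simp add: powr_add flip: powr_of_real)
  have "C_factor q (of_real a) n
      * racah_u q (of_real \<alpha>) (of_real \<beta>) (of_real a) (of_real (a + real N + 1)) n (s + of_real a)
    = qpochs [?B, ?D] ?Q n * qpoch (g a) ?Q n / qpoch ?A ?Q n
      * basic_hypergeometric [qpow q (- of_nat n), ?A, x_lattice q s, f a] [?B, ?D, g a] ?Q ?Q"
    for a :: real
  proof -
    \<comment> \<open>The choice of b makes the first lower parameter q^(-N), and the shift of s by
      a turns q^(a-s) into x(s); in the two remaining exponents a is doubled.\<close>
    have "complex_of_real a - of_real (a + real N + 1) + 1 = - of_nat N"
      and "complex_of_real a - (s + of_real a) = - s"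
      and "complex_of_real a + (s + of_real a) + 1 = of_real (2 * a) + (s + 1)"
      and "complex_of_real a + of_real (a + real N + 1) + of_real \<alpha> + 1
        = of_real (2 * a) + of_real (real N + \<alpha> + 2)"
      by simp_all
    then show ?thesis
      by (simp only: C_factor_mult_racah_u[OF assms] A D f_def g_def x_lattice_def)
        (simp add: qpochs_def mult_ac)
  qed
  moreover have "((\<lambda>a. qpochs [?B, ?D] ?Q n * qpoch (g a) ?Q n / qpoch ?A ?Q n
      * basic_hypergeometric [qpow q (- of_nat n), ?A, x_lattice q s, f a] [?B, ?D, g a] ?Q ?Q)
    \<longlongrightarrow> qpochs [?B, ?D] ?Q n * 1 * inverse (qpoch ?A ?Q n)
      * basic_hypergeometric [qpow q (- of_nat n), ?A, x_lattice q s] [?B, ?D] ?Q ?Q) at_top"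
    \<comment> \<open>The fixed denominator becomes a constant factor, so its nonvanishing does not
      enter the limit.\<close>
    unfolding divide_inverse
    by (intro tendsto_mult tendsto_const qpoch_tendsto_1 g
        basic_hypergeometric_4_3_tendsto_3_2 assms f)
  ultimately show ?thesis by (simp add: hahn_h_def divide_inverse)
qed

theorem theorem3:
  fixes q \<alpha>t \<beta>t \<alpha> \<beta> :: real and N :: nat
  assumes "0 < q" and "q < 1" and "N \<ge> 1"
    and "(0 < \<alpha>t * q \<and> \<alpha>t * q < 1 \<and> 0 < \<beta>t * q \<and> \<beta>t * q < 1)
         \<or> (\<alpha>t > q powr (- real N) \<and> \<beta>t > q powr (- real N))"
    and "q powr \<alpha> = \<beta>t" and "q powr \<beta> = \<alpha>t"
  shows "(\<forall>s::complex.
            ((\<lambda>a::real. mu_tilde q (of_real a) s) \<longlongrightarrow> x_lattice q s) at_top)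
       \<and> (\<forall>n\<le>N. \<forall>s\<le>N.
            ((\<lambda>a::real. let b = a + real N + 1 in
                C_factor q (of_real a) n
                * racah_u q (of_real \<alpha>) (of_real \<beta>) (of_real a) (of_real b) n (of_nat s + of_real a))
             \<longlongrightarrow> hahn_h q (of_real \<alpha>t) (of_real \<beta>t) N n (x_lattice q (of_nat s))) at_top)"
  using mu_tilde_tendsto[OF assms(1,2)]
    racah_u_tendsto_hahn_h[OF assms(1,2), of _ \<alpha> \<beta> N "of_nat _"] assms(5,6)
  by (simp add: Let_def)

end
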